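(* Let $a,b,c,d>0$ with $ad=bc$, and let $\{W_n(z)\}_{n\ge0}$ be defined by $W_0(z)=1$, $W_1(z)=z$, $W_n(z)=(az+b)W_{n-1}(z)+(cz+d)W_{n-2}(z)$ for $n\ge2$. Let $\Delta_\Delta=-a^2d+abc+c^2$, $\Delta_g=(b+c)^2+4d(1-a)$, $x_\Delta^{-}=\frac{-ab-2c-2\sqrt{\Delta_\Delta}}{a^2}$, $x_g^\pm=\frac{b+c}{2(1-a)}\pm\frac{\sqrt{\Delta_g}}{2|1-a|}$ if $a\ne1$ and $x_g^\pm=-\frac{d}{b+c}$ if $a=1$. Let $u=x_\Delta^-$ if $a\le2$ and $u=x_g^-$ if $a>2$; let $v=x_g^-$ if $a\le1$ and $v=x_g^+$ if $a>1$. Then for every $n\ge0$ the function $W_n(z)/(az+b)^{\lfloor n/2\rfloor}$ is a polynomial; denote its zero set by $S_n$. For every $n\ge1$, \[ |S_{2n}\cap(u,v)|=n,\qquad |S_{2n-1}\cap(u,v)|=n-1,\qquad |S_{2n-1}\cap(v,0]|=1. \] Moreover, for every $k\in\{1,2\}$ and every $n\ge k+1$, the set $S_n\cap(u,v)$ strictly interlaces $S_{n-k}\cap(u,v)$ from the left if $n$ is odd, and from the right if $n$ is even.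
   Context: Under $ad=bc$ the numbers $\Delta_\Delta,\Delta_g$ are positive, so $x_\Delta^-,x_g^\pm$ are real. For finite sets $X,Y\subset\mathbb{R}$ with $|X|-|Y|\in\{0,1\}$: $X$ strictly interlaces $Y$ from the left if the elements $x_i$ of $X$ and $y_j$ of $Y$ can be arranged as $x_1<y_1<x_2<y_2<\cdots$; $X$ strictly interlaces $Y$ from the right if they can be arranged as $x_1>y_1>x_2>y_2>\cdots$. *)

theory Defs
  imports "HOL-Computational_Algebra.Polynomial" Complex_Main
begin

fun W :: "real \<Rightarrow> real \<Rightarrow> real \<Rightarrow> real \<Rightarrow> nat \<Rightarrow> real poly" where
  "W a b c d 0 = 1"
| "W a b c d (Suc 0) = [:0, 1:]"
| "W a b c d (Suc (Suc n)) = [:b, a:] * W a b c d (Suc n) + [:d, c:] * W a b c d n"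

definition Delta_Delta :: "real \<Rightarrow> real \<Rightarrow> real \<Rightarrow> real \<Rightarrow> real" where
  "Delta_Delta a b c d = - (a^2 * d) + a * b * c + c^2"

definition Delta_g :: "real \<Rightarrow> real \<Rightarrow> real \<Rightarrow> real \<Rightarrow> real" where
  "Delta_g a b c d = (b + c)^2 + 4 * d * (1 - a)"

definition x_Delta_minus :: "real \<Rightarrow> real \<Rightarrow> real \<Rightarrow> real \<Rightarrow> real" where
  "x_Delta_minus a b c d = (- (a * b) - 2 * c - 2 * sqrt (Delta_Delta a b c d)) / a^2"

definition x_g_plus :: "real \<Rightarrow> real \<Rightarrow> real \<Rightarrow> real \<Rightarrow> real" where
  "x_g_plus a b c d =
     (if a = 1 then - (d / (b + c))
      else (b + c) / (2 * (1 - a)) + sqrt (Delta_g a b c d) / (2 * \<bar>1 - a\<bar>))"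

definition x_g_minus :: "real \<Rightarrow> real \<Rightarrow> real \<Rightarrow> real \<Rightarrow> real" where
  "x_g_minus a b c d =
     (if a = 1 then - (d / (b + c))
      else (b + c) / (2 * (1 - a)) - sqrt (Delta_g a b c d) / (2 * \<bar>1 - a\<bar>))"

definition u_end :: "real \<Rightarrow> real \<Rightarrow> real \<Rightarrow> real \<Rightarrow> real" where
  "u_end a b c d = (if a \<le> 2 then x_Delta_minus a b c d else x_g_minus a b c d)"

definition v_end :: "real \<Rightarrow> real \<Rightarrow> real \<Rightarrow> real \<Rightarrow> real" where
  "v_end a b c d = (if a \<le> 1 then x_g_minus a b c d else x_g_plus a b c d)"

(* The real zeros of W_n(z) / (az+b)^(n div 2), as a set without multiplicities. The polynomial
   division is meaningful only when exact, i.e. when (az+b)^(n div 2) divides W_n. Only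
   intersections of the zero set with real intervals are considered, so real zeros suffice. *)
definition S :: "real \<Rightarrow> real \<Rightarrow> real \<Rightarrow> real \<Rightarrow> nat \<Rightarrow> real set" where
  "S a b c d n = {x. poly (W a b c d n div [:b, a:] ^ (n div 2)) x = 0}"

(* splice [x1,x2,...] [y1,y2,...] = [x1,y1,x2,y2,...]; by the length condition the alternation
   is never broken, and by the strict ordering the lists enumerate X and Y without repetition. *)
definition interlaces_left :: "real set \<Rightarrow> real set \<Rightarrow> bool" where
  "interlaces_left X Y \<longleftrightarrow>
     (\<exists>xs ys. set xs = X \<and> set ys = Y \<and>
        (length xs = length ys \<or> length xs = length ys + 1) \<and> sorted_wrt (<) (splice xs ys))"

definition interlaces_right :: "real set \<Rightarrow> real set \<Rightarrow> bool" where
  "interlaces_right X Y \<longleftrightarrow>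
     (\<exists>xs ys. set xs = X \<and> set ys = Y \<and>
        (length xs = length ys \<or> length xs = length ys + 1) \<and> sorted_wrt (>) (splice xs ys))"

end

theory Submission
  imports Defs
begin

text \<open>
  Since \<open>ad = bc\<close>, the coefficient \<open>cz + d\<close> equals \<open>kA\<close> with \<open>A = az + b\<close> and \<open>k = c/a\<close>. Dividing
  \<open>W\<^sub>2\<^sub>m\<close> and \<open>W\<^sub>2\<^sub>m\<^sub>+\<^sub>1\<close> by \<open>A\<^sup>m\<close> leaves polynomials \<open>e\<^sub>m\<close>, \<open>o\<^sub>m\<close> of degrees \<open>m\<close>, \<open>m + 1\<close> with
  \<open>e\<^sub>m\<^sub>+\<^sub>1 = o\<^sub>m + k e\<^sub>m\<close> and \<open>o\<^sub>m\<^sub>+\<^sub>1 = A e\<^sub>m\<^sub>+\<^sub>1 + k o\<^sub>m\<close>. At a root of one of the last two terms the sign of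
  the new polynomial is that of the other term, up to the sign of \<open>A\<close>. Together with the signs at
  \<open>u\<close> and \<open>v\<close> this forces, by the intermediate value theorem, as many sign changes as the degree
  allows. The one delicate point is that \<open>A\<close> must be negative at the roots of \<open>o\<^sub>m\<close> in \<open>(u, v)\<close>; this
  propagates because \<open>o\<^sub>m(-b/a) = k\<^sup>m(-b/a) < 0\<close>.

  The endpoint \<open>v\<close> is a root of \<open>z\<^sup>2 = A(z + k)\<close>, where \<open>W\<^sub>n = z\<^sup>n\<close>. So is \<open>u\<close> if \<open>a > 2\<close>; otherwise
  \<open>A = -4k\<close> at \<open>u\<close>, where the characteristic equation has a double root.
\<close>

section \<open>The reduced polynomials\<close>

text \<open>The last clause writes out \<open>ev a b k (Suc m)\<close>, so that every recursive call
  is at \<open>m\<close>.\<close>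

fun ev od :: "real \<Rightarrow> real \<Rightarrow> real \<Rightarrow> nat \<Rightarrow> real poly" where
  "ev a b k 0 = 1"
| "od a b k 0 = [:0, 1:]"
| "ev a b k (Suc m) = od a b k m + smult k (ev a b k m)"
| "od a b k (Suc m) = [:b, a:] * (od a b k m + smult k (ev a b k m)) + smult k (od a b k m)"

text \<open>Since \<open>[:d, c:]\<close> is a multiple of \<open>[:b, a:]\<close>, every recursion
  step brings one factor \<open>[:b, a:]\<close>, and an even index \<open>2 * Suc m\<close> uses it
  up. At the next odd index the first summand has one factor to spare, which stays inside
  \<open>od\<close>.\<close>

lemma W_factorization:
  fixes a b c d :: real
  assumes "a > 0" and "a * d = b * c"
  shows "W a b c d (2 * m) = [:b, a:] ^ m * ev a b (c / a) m"
    and "W a b c d (Suc (2 * m)) = [:b, a:] ^ m * od a b (c / a) m"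
proof -
  have lin: "[:d, c:] = smult (c / a) [:b, a:]"
    using assms by (simp add: field_simps)
  have "W a b c d (2 * m) = [:b, a:] ^ m * ev a b (c / a) m
      \<and> W a b c d (Suc (2 * m)) = [:b, a:] ^ m * od a b (c / a) m"
  proof (induction m)
    case (Suc m)
    have e: "W a b c d (2 * Suc m) = [:b, a:] ^ Suc m * ev a b (c / a) (Suc m)"
      using Suc by (simp add: lin algebra_simps del: mult_pCons_left mult_pCons_right smult_pCons)
    have "W a b c d (Suc (2 * Suc m))
        = [:b, a:] * W a b c d (2 * Suc m) + [:d, c:] * W a b c d (Suc (2 * m))"
      by (simp del: mult_pCons_left mult_pCons_right)
    also have "\<dots> = [:b, a:] ^ Suc m * od a b (c / a) (Suc m)"
      unfolding e using Suc
      by (simp add: lin algebra_simps del: mult_pCons_left mult_pCons_right smult_pCons)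
    finally show ?case using e by blast
  qed simp
  then show "W a b c d (2 * m) = [:b, a:] ^ m * ev a b (c / a) m"
    and "W a b c d (Suc (2 * m)) = [:b, a:] ^ m * od a b (c / a) m" by auto
qed

lemma S_eq:
  fixes a b c d :: real
  assumes "a > 0" and "a * d = b * c"
  shows "S a b c d (2 * m) = {x. poly (ev a b (c / a) m) x = 0}"
    and "S a b c d (Suc (2 * m)) = {x. poly (od a b (c / a) m) x = 0}"
proof -
  show "S a b c d (2 * m) = {x. poly (ev a b (c / a) m) x = 0}"
    and "S a b c d (Suc (2 * m)) = {x. poly (od a b (c / a) m) x = 0}"
    unfolding S_def W_factorization[OF assms] using assms(1) by simp_all
qed

lemma pow_dvd_W:
  fixes a b c d :: real
  assumes "a > 0" and "a * d = b * c"
  shows "[:b, a:] ^ (n div 2) dvd W a b c d n"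
proof (cases "even n")
  case True
  then obtain m where "n = 2 * m" by blast
  then show ?thesis using W_factorization(1)[OF assms, of m] by simp
next
  case False
  then obtain m where "n = Suc (2 * m)" by (metis oddE Suc_eq_plus1)
  then show ?thesis using W_factorization(2)[OF assms, of m] by simp
qed

lemma degree_ev_od: "degree (ev a b k m) \<le> m \<and> degree (od a b k m) \<le> Suc m"
proof (induction m)
  case (Suc m)
  have e: "degree (ev a b k (Suc m)) \<le> Suc m"
    using Suc by (auto intro!: degree_add_le intro: order_trans[OF degree_smult_le])
  have "degree ([:b, a:] * ev a b k (Suc m)) \<le> Suc (Suc m)"
    by (rule order_trans[OF degree_mult_le]) (use e in auto)
  moreover have "degree (smult k (od a b k m)) \<le> Suc (Suc m)"
    using Suc by (auto intro: order_trans[OF degree_smult_le])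
  ultimately have "degree (od a b k (Suc m)) \<le> Suc (Suc m)"
    by (auto intro!: degree_add_le simp del: mult_pCons_left)
  with e show ?case by blast
qed simp

section \<open>Real roots of polynomials\<close>

text \<open>Roots found by sign changes are all the roots once their number reaches the
  degree.\<close>

lemma poly_roots_eqI:
  fixes p :: "real poly"
  assumes "p \<noteq> 0" and "\<And>x. x \<in> R \<Longrightarrow> poly p x = 0" and "degree p \<le> card R"
  shows "{x. poly p x = 0} = R"
  using assms card_poly_roots_bound[of p] poly_roots_finite[of p]
  by (intro card_seteq[symmetric]) auto

text \<open>Carries a sign along a root-free interval; \<open>s\<close> will be an alternating sign
  such as \<open>- ((-1) ^ i)\<close>.\<close>

lemma poly_pos_if_no_root:
  fixes p :: "real poly"
  assumes "s * poly p x > 0" and "x \<le> y" and "\<And>z. x \<le> z \<Longrightarrow> z \<le> y \<Longrightarrow> poly p z \<noteq> 0"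
  shows "s * poly p y > 0"
proof (rule ccontr)
  assume neg: "\<not> s * poly p y > 0"
  have "\<exists>z\<ge>x. z \<le> y \<and> s * poly p z = 0"
    by (rule IVT2') (use assms neg in \<open>auto intro!: continuous_intros\<close>)
  moreover have "s \<noteq> 0" using assms(1) by auto
  ultimately show False using assms(3) by auto
qed

lemma poly_root_between:
  fixes p :: "real poly"
  assumes "s * poly p x > 0" and "s * poly p y < 0" and "x < y"
  shows "\<exists>z. x < z \<and> z < y \<and> poly p z = 0"
proof -
  have "poly p x * poly p y < 0"
    using assms(1,2) by (smt (verit) mult_less_0_iff zero_less_mult_iff)
  then show ?thesis using poly_IVT[OF assms(3)] by blast
qed

section \<open>Decreasing enumerations and interlacing of finite sets\<close>

lemma strictly_decreasing_below:
  fixes f :: "nat \<Rightarrow> real"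
  assumes "\<And>i. Suc i < m \<Longrightarrow> f (Suc i) < f i" and "i < j" and "j < m"
  shows "f j < f i"
  using assms(2,3)
proof (induction j)
  case (Suc j)
  then show ?case using assms(1)[of j] by (cases "i = j") auto
qed simp

lemma inj_on_decreasing:
  fixes f :: "nat \<Rightarrow> real"
  assumes "\<And>i. Suc i < m \<Longrightarrow> f (Suc i) < f i"
  shows "inj_on f {..<m}"
proof (rule inj_onI)
  fix i j assume "i \<in> {..<m}" "j \<in> {..<m}" "f i = f j"
  then show "i = j"
    using strictly_decreasing_below[of m f, OF assms, of i j]
      strictly_decreasing_below[of m f, OF assms, of j i]
    by (cases i j rule: linorder_cases) auto
qed

text \<open>Splitting off the head of the first list swaps the two lists, and the hypotheses keep
  their form under this swap. Hence the induction is on \<open>l + m\<close> with both functions and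
  both lengths arbitrary.\<close>

lemma sorted_wrt_splice:
  fixes f g :: "nat \<Rightarrow> 'a"
  assumes "transp R" and "l = m \<or> l = Suc m"
    and "\<And>i. i < m \<Longrightarrow> R (f i) (g i)" and "\<And>i. Suc i < l \<Longrightarrow> R (g i) (f (Suc i))"
  shows "sorted_wrt R (splice (map f [0..<l]) (map g [0..<m]))"
  using assms(2-)
proof (induction "l + m" arbitrary: l m f g)
  case (Suc n)
  obtain l' where l: "l = Suc l'" using Suc.hyps(2) Suc.prems(1) by (cases l) auto
  have f: "map f [0..<l] = f 0 # map (f \<circ> Suc) [0..<l']"
    unfolding l by (simp add: upt_conv_Cons map_Suc_upt[symmetric] del: upt_Suc)
  have IH: "sorted_wrt R (splice (map g [0..<m]) (map (f \<circ> Suc) [0..<l']))"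
    by (rule Suc.hyps(1)) (use Suc l in auto)
  show ?case
  proof (cases m)
    case 0
    then have "l' = 0" using l Suc.prems by auto
    then show ?thesis using 0 by (simp add: f)
  next
    case (Suc m')
    have g: "map g [0..<m] = g 0 # map (g \<circ> Suc) [0..<m']"
      unfolding Suc by (simp add: upt_conv_Cons map_Suc_upt[symmetric] del: upt_Suc)
    show ?thesis using IH Suc.prems(2)[of 0] Suc
      unfolding f g splice.simps sorted_wrt2[OF assms(1)] by simp
  qed
qed simp

lemma interlaces_rightI:
  assumes "l = m \<or> l = Suc m"
    and "\<And>i. i < m \<Longrightarrow> g i < f i" and "\<And>i. Suc i < l \<Longrightarrow> f (Suc i) < g i"
  shows "interlaces_right (f ` {..<l}) (g ` {..<m})"
proof -
  have "sorted_wrt (>) (splice (map f [0..<l]) (map g [0..<m]))"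
    by (rule sorted_wrt_splice) (use assms in auto)
  then show ?thesis unfolding interlaces_right_def using assms(1)
    by (intro exI[of _ "map f [0..<l]"] exI[of _ "map g [0..<m]"]) (auto simp: atLeast0LessThan)
qed

lemma interlaces_leftI:
  assumes "l = m \<or> l = Suc m"
    and "\<And>i. i < m \<Longrightarrow> f i < g i" and "\<And>i. Suc i < l \<Longrightarrow> g i < f (Suc i)"
  shows "interlaces_left (f ` {..<l}) (g ` {..<m})"
proof -
  have "sorted_wrt (<) (splice (map f [0..<l]) (map g [0..<m]))"
    by (rule sorted_wrt_splice) (use assms in auto)
  then show ?thesis unfolding interlaces_left_def using assms(1)
    by (intro exI[of _ "map f [0..<l]"] exI[of _ "map g [0..<m]"]) (auto simp: atLeast0LessThan)
qed

text \<open>Roots are listed in decreasing order below, whereas \<open>interlaces_left\<close> asks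
  for increasing lists.\<close>

lemma image_reversed: "(\<lambda>i. f (m - Suc i)) ` {..<m} = f ` {..<m::nat}"
proof (intro equalityI subsetI)
  fix z assume "z \<in> f ` {..<m}"
  then obtain i where "i < m" "z = f (m - Suc (m - Suc i))" by auto
  then show "z \<in> (\<lambda>i. f (m - Suc i)) ` {..<m}" by (intro image_eqI[of _ _ "m - Suc i"]) auto
qed auto

section \<open>Root patterns\<close>

text \<open>Collects what the root argument uses about the endpoints, apart from their closed forms;
  \<open>k\<close> stands for \<open>c / a\<close>.\<close>

locale endpoints =
  fixes a b k u v :: real
  assumes a_pos: "a > 0" and b_pos: "b > 0" and k_pos: "k > 0"
    and v_neg: "v < 0" and Av_pos: "a * v + b > 0" and v_eq: "v\<^sup>2 = (a * v + b) * (v + k)"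
    and Au_neg: "a * u + b < 0"
    and u_cases: "a * u + b = - 4 * k \<and> u \<le> - 2 * k \<or> u\<^sup>2 = (a * u + b) * (u + k)"
begin

abbreviation "E m \<equiv> ev a b k m"
abbreviation "D m \<equiv> od a b k m"

lemma poly_E_Suc: "poly (E (Suc m)) x = poly (D m) x + k * poly (E m) x"
  by simp

lemma poly_D_Suc: "poly (D (Suc m)) x = (a * x + b) * poly (E (Suc m)) x + k * poly (D m) x"
  by (simp add: algebra_simps)

declare ev.simps(2) [simp del] od.simps(2) [simp del]

section \<open>Signs of the reduced polynomials at the pole, at the endpoints and at zero\<close>

lemma u_less_v: "u < v"
  using Av_pos Au_neg a_pos by (smt (verit) mult_le_cancel_left_pos)

lemma u_less_pole: "u < - b / a"
  using Au_neg a_pos by (simp add: field_simps)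

lemma pole_less_v: "- b / a < v"
  using Av_pos a_pos by (simp add: field_simps)

lemma D_at_pole: "poly (D m) (- b / a) < 0"
proof -
  have "poly (D m) (- b / a) = k ^ m * (- b / a)"
    by (induction m) (use a_pos in \<open>simp_all add: poly_D_Suc\<close>)
  then show ?thesis using a_pos b_pos k_pos by (simp add: mult_pos_neg)
qed

text \<open>The ratio of consecutive terms starts at \<open>z\<close>, and the hypothesis says that
  \<open>z\<close> solves the characteristic equation t^2 = A t + k A with A = az + b. So the ratio
  remains \<open>z\<close>.\<close>

lemma D_eq_at_fixed:
  assumes "z\<^sup>2 = (a * z + b) * (z + k)"
  shows "poly (D m) z = z * poly (E m) z"
proof (induction m)
  case (Suc m)
  have "poly (D (Suc m)) z = ((a * z + b) * (z + k) + k * z) * poly (E m) z"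
    unfolding poly_D_Suc poly_E_Suc Suc by (simp add: algebra_simps)
  also have "\<dots> = z * poly (E (Suc m)) z"
    unfolding assms[symmetric] poly_E_Suc Suc by (simp add: algebra_simps power2_eq_square)
  finally show ?case .
qed simp

lemma E_at_v: "poly (E m) v > 0"
proof (induction m)
  case (Suc m)
  have "(a * v + b) * (v + k) > 0" using v_eq v_neg by (metis less_irrefl zero_less_power2)
  then have "v + k > 0" using Av_pos by (simp add: zero_less_mult_iff)
  then show ?case using Suc unfolding poly_E_Suc D_eq_at_fixed[OF v_eq]
    by (metis distrib_right mult_pos_pos)
qed simp

lemma D_at_v: "poly (D m) v < 0"
  unfolding D_eq_at_fixed[OF v_eq] using E_at_v v_neg by (simp add: mult_neg_pos)

text \<open>If \<open>u\<close> is a fixed point, \<open>E\<close> is multiplied by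
  \<open>u + k < 0\<close> at each step and \<open>D = u * E\<close>. Otherwise the characteristic
  equation has the double root \<open>- 2 * k\<close>, and the ratio of \<open>D\<close> to
  \<open>E\<close> stays at or below it.\<close>

lemma signs_at_u: "(-1) ^ m * poly (E m) u > 0 \<and> (-1) ^ m * poly (D m) u < 0"
  using u_cases
proof
  assume fixed: "u\<^sup>2 = (a * u + b) * (u + k)"
  have u_neg: "u < 0" using u_less_pole a_pos b_pos by (smt (verit) divide_neg_pos)
  then have "(a * u + b) * (u + k) > 0" using fixed by (metis less_irrefl zero_less_power2)
  then have uk: "u + k < 0" using Au_neg by (simp add: zero_less_mult_iff)
  have "(-1) ^ m * poly (E m) u > 0"
  proof (induction m)
    case (Suc m)
    have "(-1) ^ Suc m * poly (E (Suc m)) u = - (u + k) * ((-1) ^ m * poly (E m) u)"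
      unfolding poly_E_Suc D_eq_at_fixed[OF fixed] by (simp add: algebra_simps)
    then show ?case using Suc uk by (simp only: mult_pos_pos neg_0_less_iff_less)
  qed simp
  moreover have "(-1) ^ m * poly (D m) u = u * ((-1) ^ m * poly (E m) u)"
    unfolding D_eq_at_fixed[OF fixed] by simp
  ultimately show ?thesis using u_neg by (simp only: mult_neg_pos)
next
  assume dbl: "a * u + b = - 4 * k \<and> u \<le> - 2 * k"
  define q where "q m = (-1) ^ m * poly (E m) u" for m
  define r where "r m = - ((-1) ^ m * poly (D m) u)" for m
  have q_Suc: "q (Suc m) = r m - k * q m" for m
    unfolding q_def r_def poly_E_Suc by (simp add: algebra_simps)
  have r_Suc: "r (Suc m) = 4 * k * q (Suc m) - k * r m" for m
    using dbl unfolding q_def r_def poly_D_Suc by (simp add: algebra_simps)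
  \<comment> \<open>The bound survives a step: r \<ge> 2kq gives q' = r - kq \<ge> kq > 0 and 2q' =
    2r - 2kq \<ge> r, whence r' = 4kq' - kr \<ge> 2kq'. It starts with
    \<open>u \<le> - 2 * k\<close>.\<close>
  have "q m > 0 \<and> r m \<ge> 2 * (k * q m)"
  proof (induction m)
    case 0
    then show ?case using dbl by (simp add: q_def r_def)
  next
    case (Suc m)
    have kq: "k * q m > 0" using Suc k_pos by simp
    have "k * (2 * q (Suc m)) \<ge> k * r m"
      using Suc k_pos by (intro mult_left_mono) (auto simp: q_Suc)
    then show ?case using Suc kq by (auto simp: r_Suc) (auto simp: q_Suc)
  qed
  moreover from this have "k * q m > 0" using k_pos by simp
  ultimately show ?thesis unfolding q_def r_def by linarith
qed

text \<open>Equality occurs: \<open>D 0\<close> vanishes at 0, so the root above \<open>v\<close>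
  can be 0 itself.\<close>

lemma at_zero: "poly (E m) 0 \<ge> 0 \<and> poly (D m) 0 \<ge> 0"
  by (induction m) (use b_pos k_pos in \<open>auto simp: poly_D_Suc poly_E_Suc\<close>)

lemma D_root_above_v: "\<exists>r. v < r \<and> r \<le> 0 \<and> poly (D m) r = 0"
proof -
  have "\<exists>r\<ge>v. r \<le> 0 \<and> poly (D m) r = 0"
    by (rule IVT') (use D_at_v[of m] at_zero[of m] v_neg in \<open>auto intro!: continuous_intros\<close>)
  then show ?thesis using D_at_v[of m] by (metis less_irrefl order_le_less)
qed

text \<open>
  The sequences \<open>y\<close> and \<open>x\<close> list the roots of \<open>E m\<close> and \<open>D m\<close> below \<open>v\<close> in decreasing order, so
  \<open>y\<^sub>0 > x\<^sub>0 > y\<^sub>1 > x\<^sub>1 > \<dots>\<close>; values at indices from \<open>m\<close> on are junk. The remaining root of \<open>D m\<close>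
  is \<open>r\<close>.
\<close>
definition pattern :: "nat \<Rightarrow> (nat \<Rightarrow> real) \<Rightarrow> (nat \<Rightarrow> real) \<Rightarrow> real \<Rightarrow> bool" where
  "pattern m y x r \<longleftrightarrow>
     {z. poly (E m) z = 0} = y ` {..<m} \<and>
     {z. poly (D m) z = 0} = insert r (x ` {..<m}) \<and> v < r \<and> r \<le> 0 \<and>
     (\<forall>i<m. u < x i \<and> x i < y i \<and> y i < v \<and> x i < - b / a \<and>
            (-1) ^ i * poly (D m) (y i) < 0 \<and> (-1) ^ i * poly (E m) (x i) < 0) \<and>
     (\<forall>i. Suc i < m \<longrightarrow> y (Suc i) < x i)"

text \<open>Sign changes between old roots and endpoints give \<open>Suc m\<close> roots
  \<open>Y\<close> of the new \<open>E\<close>; sign changes between the old \<open>x\<close> and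
  the new \<open>Y\<close> then give the roots \<open>X\<close> of the new \<open>D\<close>. The
  added inequalities compare old with new roots, as interlacing across two indices requires.\<close>

lemma pattern_Suc:
  assumes "pattern m y x r"
  shows "\<exists>Y X R. pattern (Suc m) Y X R \<and>
    (\<forall>i<m. y i < Y i \<and> Y (Suc i) < x i \<and> x i < X i \<and> X (Suc i) < x i)"
proof -
  from assms have Er: "{z. poly (E m) z = 0} = y ` {..<m}"
    and Dr: "{z. poly (D m) z = 0} = insert r (x ` {..<m})" and r: "v < r" "r \<le> 0"
    and ux: "\<And>i. i < m \<Longrightarrow> u < x i" and xy: "\<And>i. i < m \<Longrightarrow> x i < y i"
    and yv: "\<And>i. i < m \<Longrightarrow> y i < v" and xb: "\<And>i. i < m \<Longrightarrow> x i < - b / a"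
    and Dy: "\<And>i. i < m \<Longrightarrow> (-1) ^ i * poly (D m) (y i) < 0"
    and Ex: "\<And>i. i < m \<Longrightarrow> (-1) ^ i * poly (E m) (x i) < 0"
    and yx: "\<And>i. Suc i < m \<Longrightarrow> y (Suc i) < x i"
    unfolding pattern_def by auto
  have E0: "poly (E m) (y i) = 0" if "i < m" for i using Er that by blast
  have D0: "poly (D m) (x i) = 0" if "i < m" for i using Dr that by blast
  have "x (Suc i) < x i" if "Suc i < m" for i using xy[of "Suc i"] yx[of i] that by simp
  note x_dec = strictly_decreasing_below[of m x, OF this]

  \<comment> \<open>The gap for \<open>Y i\<close> reaches from \<open>y i\<close> up to
    \<open>x (i - 1)\<close>; \<open>u\<close> and \<open>v\<close> close the lowest and the highest
    gap. At the old roots the new \<open>E\<close> is \<open>D m\<close> or \<open>k\<close> times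
    \<open>E m\<close>.\<close>
  define lo where "lo i = (if i < m then y i else u)" for i
  define hi where "hi i = (if i = 0 then v else x (i - 1))" for i
  have lohi: "lo i < hi i" if "i \<le> m" for i
    using that yv ux yx u_less_v unfolding lo_def hi_def by (cases i) auto
  have E_lo: "(-1) ^ i * poly (E (Suc m)) (lo i) < 0" if "i \<le> m" for i
    using that Dy[of i] E0[of i] signs_at_u[of "Suc m"]
    unfolding lo_def by (cases "i < m") (auto simp: poly_E_Suc[of m])
  have E_x: "(-1) ^ i * poly (E (Suc m)) (x i) < 0" if "i < m" for i
  proof -
    have "(-1) ^ i * poly (E (Suc m)) (x i) = k * ((-1) ^ i * poly (E m) (x i))"
      unfolding poly_E_Suc using D0[OF that] by simp
    then show ?thesis using Ex[OF that] k_pos by (simp only: mult_pos_neg)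
  qed
  have E_hi: "(-1) ^ i * poly (E (Suc m)) (hi i) > 0" if "i \<le> m" for i
    using that E_x[of "i - 1"] E_at_v[of "Suc m"] unfolding hi_def by (cases i) auto
  have "\<exists>z. lo i < z \<and> z < hi i \<and> poly (E (Suc m)) z = 0" if "i \<le> m" for i
    by (rule poly_root_between[of "- ((-1) ^ i)"]) (use that lohi E_lo E_hi in auto)
  then obtain Y where loY: "\<And>i. i \<le> m \<Longrightarrow> lo i < Y i" and Yhi: "\<And>i. i \<le> m \<Longrightarrow> Y i < hi i"
    and Y0: "\<And>i. i \<le> m \<Longrightarrow> poly (E (Suc m)) (Y i) = 0" by metis
  have yY: "y i < Y i" if "i < m" for i using loY[of i] that by (simp add: lo_def)
  have Yx: "Y (Suc i) < x i" if "i < m" for i using Yhi[of "Suc i"] that by (simp add: hi_def)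
  have uY: "u < Y i" if "i \<le> m" for i
    using loY[of i] ux[of i] xy[of i] that by (cases "i < m") (auto simp: lo_def)
  have Yv: "Y i < v" if "i \<le> m" for i
    using Yhi[of i] that xy[of "i - 1"] yv[of "i - 1"] by (cases i) (auto simp: hi_def)
  have "Y (Suc i) < Y i" if "Suc i < Suc m" for i
    using Yx[of i] xy[of i] yY[of i] that by simp
  note Y_dec = strictly_decreasing_below[of "Suc m" Y, OF this]
    and Y_inj = inj_on_decreasing[of "Suc m" Y, OF this]
  have E_nz: "E (Suc m) \<noteq> 0" using E_at_v[of "Suc m"] by auto
  have EY: "{z. poly (E (Suc m)) z = 0} = Y ` {..<Suc m}"
    by (rule poly_roots_eqI[OF E_nz])
      (use Y0 degree_ev_od[of a b k "Suc m"] in \<open>auto simp: card_image[OF Y_inj]\<close>)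

  have D_lo: "- ((-1) ^ i) * poly (D m) (lo i) > 0" if "i \<le> m" for i
    using that Dy[of i] signs_at_u[of m] unfolding lo_def by (cases "i < m") auto
  \<comment> \<open>No root of \<open>D m\<close> lies between \<open>lo i\<close> and
    \<open>Y i\<close>: those of index below \<open>i\<close> are at least \<open>hi i\<close>, the
    others are below \<open>lo i\<close>, and \<open>r\<close> is above \<open>v\<close>.\<close>
  have "- ((-1) ^ i) * poly (D m) (Y i) > 0" if i: "i \<le> m" for i
  proof (rule poly_pos_if_no_root[OF D_lo[OF i]])
    fix z assume z: "lo i \<le> z" "z \<le> Y i"
    have "z \<noteq> r" using z Yv[OF i] r by auto
    moreover have "z \<noteq> x j" if j: "j < m" for j
    proof (cases "j < i")
      case True
      then have "j = i - 1 \<or> j < i - 1" by arith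
      then have "x (i - 1) \<le> x j" using x_dec[of j "i - 1"] i True by (auto simp: less_imp_le)
      then show ?thesis using Yhi[OF i] z True by (auto simp: hi_def)
    next
      case False
      then have "x j \<le> x i" using x_dec[of i j] j by (cases "j = i") auto
      then show ?thesis using z False j xy[of i] by (auto simp: lo_def)
    qed
    ultimately show "poly (D m) z \<noteq> 0" using Dr by blast
  qed (use loY[OF i] in auto)
  then have DmY: "(-1) ^ i * poly (D m) (Y i) < 0" if "i \<le> m" for i using that by force
  have DY: "(-1) ^ i * poly (D (Suc m)) (Y i) < 0" if "i \<le> m" for i
  proof -
    have "(-1) ^ i * poly (D (Suc m)) (Y i) = k * ((-1) ^ i * poly (D m) (Y i))"
      unfolding poly_D_Suc Y0[OF that] by simp
    then show ?thesis using DmY[OF that] k_pos by (simp only: mult_pos_neg)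
  qed

  define lo' where "lo' i = (if i < m then x i else u)" for i
  \<comment> \<open>Cutting the top interval at the pole puts \<open>X 0\<close> to its left; each
    later \<open>X i\<close> is below \<open>x (i - 1)\<close>, which is already there.
    \<open>D_at_pole\<close> gives the sign at the cut.\<close>
  define hi' where "hi' i = (if i = 0 then min (Y 0) (- b / a) else Y i)" for i
  have hi'Y: "hi' i \<le> Y i" for i unfolding hi'_def by auto
  have lohi': "lo' i < hi' i" if "i \<le> m" for i
    using that xy[of i] yY[of i] xb[of i] uY[of i] u_less_pole
    unfolding lo'_def hi'_def by (cases "i < m") auto
  \<comment> \<open>Here the invariant \<open>x i < - b / a\<close> is used: the negative factor az
    + b reverses the sign of the new \<open>E\<close>.\<close>
  have D_x: "(-1) ^ i * poly (D (Suc m)) (x i) > 0" if "i < m" for i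
  proof -
    have "a * x i + b < 0" using xb[OF that] a_pos by (simp add: field_simps)
    moreover have "(-1) ^ i * poly (D (Suc m)) (x i)
        = (a * x i + b) * ((-1) ^ i * poly (E (Suc m)) (x i))"
      unfolding poly_D_Suc D0[OF that] by simp
    ultimately show ?thesis using E_x[OF that] by (simp only: mult_neg_neg)
  qed
  have D_lo': "(-1) ^ i * poly (D (Suc m)) (lo' i) > 0" if "i \<le> m" for i
    using that D_x[of i] signs_at_u[of "Suc m"] unfolding lo'_def by (cases "i < m") auto
  have D_hi': "(-1) ^ i * poly (D (Suc m)) (hi' i) < 0" if "i \<le> m" for i
    using that DY[of i] D_at_pole[of "Suc m"] unfolding hi'_def by (auto simp: min_def)
  have "\<exists>z. lo' i < z \<and> z < hi' i \<and> poly (D (Suc m)) z = 0" if "i \<le> m" for i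
    by (rule poly_root_between[of "(-1) ^ i"]) (use that lohi' D_lo' D_hi' in auto)
  then obtain X where loX: "\<And>i. i \<le> m \<Longrightarrow> lo' i < X i" and Xhi: "\<And>i. i \<le> m \<Longrightarrow> X i < hi' i"
    and X0: "\<And>i. i \<le> m \<Longrightarrow> poly (D (Suc m)) (X i) = 0" by metis
  have XY: "X i < Y i" if "i \<le> m" for i using Xhi[OF that] hi'Y[of i] by simp
  have xX: "x i < X i" if "i < m" for i using loX[of i] that by (simp add: lo'_def)
  have Xx: "X (Suc i) < x i" if "i < m" for i using XY[of "Suc i"] Yx[of i] that by simp
  have uX: "u < X i" if "i \<le> m" for i
    using loX[of i] ux[of i] that by (cases "i < m") (auto simp: lo'_def)
  have Xb: "X i < - b / a" if "i \<le> m" for i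
  proof (cases i)
    case 0
    then show ?thesis using Xhi[of 0] by (simp add: hi'_def)
  next
    case (Suc j)
    then show ?thesis using Xx[of j] xb[of j] that by simp
  qed
  have "X (Suc i) < X i" if "Suc i < Suc m" for i using Xx[of i] xX[of i] that by simp
  note X_inj = inj_on_decreasing[of "Suc m" X, OF this]
  obtain R where R: "v < R" "R \<le> 0" "poly (D (Suc m)) R = 0" using D_root_above_v by blast
  have R_notin: "R \<notin> X ` {..<Suc m}" using R(1) Xb pole_less_v by (auto simp: less_Suc_eq_le) (meson less_asym less_trans)
  have D_nz: "D (Suc m) \<noteq> 0" using D_at_v[of "Suc m"] by auto
  \<comment> \<open>\<open>Suc m\<close> roots below \<open>v\<close> and \<open>R\<close> above it
    exhaust the degree bound \<open>Suc (Suc m)\<close>.\<close>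
  have DX: "{z. poly (D (Suc m)) z = 0} = insert R (X ` {..<Suc m})"
    by (rule poly_roots_eqI[OF D_nz])
      (use X0 R R_notin degree_ev_od[of a b k "Suc m"] in \<open>auto simp: card_image[OF X_inj]\<close>)

  have E_lo': "- ((-1) ^ i) * poly (E (Suc m)) (lo' i) > 0" if "i \<le> m" for i
    using that E_x[of i] signs_at_u[of "Suc m"] unfolding lo'_def by (cases "i < m") auto
  \<comment> \<open>The same transport for the new \<open>E\<close>: its roots are either at least
    \<open>Y i\<close>, hence above \<open>X i\<close>, or below \<open>lo' i\<close>.\<close>
  have "- ((-1) ^ i) * poly (E (Suc m)) (X i) > 0" if i: "i \<le> m" for i
  proof (rule poly_pos_if_no_root[OF E_lo'[OF i]])
    fix z assume z: "lo' i \<le> z" "z \<le> X i"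
    have "z \<noteq> Y j" if j: "j \<le> m" for j
    proof (cases "j \<le> i")
      case True
      then have "Y i \<le> Y j" using Y_dec[of j i] i by (cases "j = i") auto
      then show ?thesis using XY[OF i] z by auto
    next
      case False
      then have "Y j \<le> Y (Suc i)" using Y_dec[of "Suc i" j] j by (cases "j = Suc i") auto
      then show ?thesis using z False j Yx[of i] by (auto simp: lo'_def)
    qed
    then have "z \<notin> Y ` {..<Suc m}" by (force simp: less_Suc_eq_le)
    then show "poly (E (Suc m)) z \<noteq> 0" using EY by blast
  qed (use loX[OF i] in auto)
  then have EX: "(-1) ^ i * poly (E (Suc m)) (X i) < 0" if "i \<le> m" for i using that by force

  have "Y (Suc i) < X i" if "Suc i < Suc m" for i using Yx[of i] xX[of i] that by simp
  then have "pattern (Suc m) Y X R"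
    unfolding pattern_def using EY DX R uX XY Yv Xb DY EX by (auto simp: less_Suc_eq_le)
  then show ?thesis using yY Yx xX Xx by blast
qed

section \<open>Root counts and interlacing from the patterns\<close>

lemma pattern_exists: "\<exists>y x r. pattern m y x r"
proof (induction m)
  case 0
  have "pattern 0 (\<lambda>_. 0) (\<lambda>_. 0) 0" using v_neg by (auto simp: pattern_def)
  then show ?case by blast
next
  case (Suc m)
  then show ?case using pattern_Suc by blast
qed

lemma pattern_sets:
  assumes "pattern m y x r"
  shows "{z. poly (E m) z = 0} \<inter> {u<..<v} = y ` {..<m}"
    and "{z. poly (D m) z = 0} \<inter> {u<..<v} = x ` {..<m}"
    and "{z. poly (D m) z = 0} \<inter> {v<..0} = {r}"
    and "inj_on y {..<m}" and "inj_on x {..<m}"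
proof -
  have bd: "u < x i" "x i < y i" "y i < v" if "i < m" for i
    using assms that unfolding pattern_def by auto
  have yx: "y (Suc i) < x i" if "Suc i < m" for i
    using assms that unfolding pattern_def by auto
  have roots: "{z. poly (E m) z = 0} = y ` {..<m}"
    "{z. poly (D m) z = 0} = insert r (x ` {..<m})" and r: "v < r" "r \<le> 0"
    using assms unfolding pattern_def by auto
  have "u < y i" and "x i < v" if "i < m" for i using bd[OF that] by simp_all
  then have sub: "y ` {..<m} \<subseteq> {u<..<v}" "x ` {..<m} \<subseteq> {u<..<v}"
    by (simp_all add: image_subset_iff bd)
  have "{u<..<v} \<inter> {v<..0} = {}" by auto
  then have sub3: "x ` {..<m} \<inter> {v<..0} = {}" using sub(2) by blast
  show "{z. poly (E m) z = 0} \<inter> {u<..<v} = y ` {..<m}"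
    unfolding roots using sub(1) by (rule Int_absorb2)
  show "{z. poly (D m) z = 0} \<inter> {u<..<v} = x ` {..<m}"
    unfolding roots using sub(2) r by (simp add: Int_absorb2)
  show "{z. poly (D m) z = 0} \<inter> {v<..0} = {r}"
    unfolding roots using sub3 r by simp
  show "inj_on y {..<m}"
    by (rule inj_on_decreasing) (metis bd(2) yx less_trans Suc_lessD)
  show "inj_on x {..<m}"
    by (rule inj_on_decreasing) (metis bd(2) yx less_trans)
qed

lemma root_counts:
  shows "card ({z. poly (E m) z = 0} \<inter> {u<..<v}) = m"
    and "card ({z. poly (D m) z = 0} \<inter> {u<..<v}) = m"
    and "card ({z. poly (D m) z = 0} \<inter> {v<..0}) = 1"
proof -
  obtain y x r where "pattern m y x r" using pattern_exists by blast
  note sets = pattern_sets[OF this]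
  show "card ({z. poly (E m) z = 0} \<inter> {u<..<v}) = m"
    and "card ({z. poly (D m) z = 0} \<inter> {u<..<v}) = m"
    and "card ({z. poly (D m) z = 0} \<inter> {v<..0}) = 1"
    unfolding sets(1-3) using sets(4,5) by (simp_all add: card_image)
qed

lemma interlacing:
  defines "EZ \<equiv> \<lambda>m. {z. poly (E m) z = 0} \<inter> {u<..<v}"
    and "DZ \<equiv> \<lambda>m. {z. poly (D m) z = 0} \<inter> {u<..<v}"
  shows "interlaces_right (EZ (Suc m)) (DZ m)" and "interlaces_right (EZ (Suc m)) (EZ m)"
    and "interlaces_left (DZ (Suc m)) (EZ (Suc m))" and "interlaces_left (DZ (Suc m)) (DZ m)"
proof -
  obtain y x r where p: "pattern m y x r" using pattern_exists by blast
  obtain Y X R where P: "pattern (Suc m) Y X R"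
    and s: "\<And>i. i < m \<Longrightarrow> y i < Y i" "\<And>i. i < m \<Longrightarrow> Y (Suc i) < x i"
      "\<And>i. i < m \<Longrightarrow> x i < X i" "\<And>i. i < m \<Longrightarrow> X (Suc i) < x i"
    using pattern_Suc[OF p] by blast
  have xy: "x i < y i" if "i < m" for i using p that unfolding pattern_def by auto
  have XY: "X i < Y i" if "i \<le> m" for i using P that unfolding pattern_def by auto
  have YX: "Y (Suc i) < X i" if "i < m" for i using P that unfolding pattern_def by auto
  note sets = pattern_sets(1,2)[OF p] pattern_sets(1,2)[OF P]
  show "interlaces_right (EZ (Suc m)) (DZ m)"
    unfolding EZ_def DZ_def sets
    by (rule interlaces_rightI) (use s xy in \<open>force+\<close>)
  show "interlaces_right (EZ (Suc m)) (EZ m)"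
    unfolding EZ_def DZ_def sets
    by (rule interlaces_rightI) (use s xy in \<open>force+\<close>)
  \<comment> \<open>The chains re-indexed from below, to match the reversed enumerations.\<close>
  have YX': "Y (m - i) < X (m - Suc i)" and Xx': "X (m - i) < x (m - Suc i)"
    and xX': "x (m - Suc i) < X (m - Suc i)" if "i < m" for i
    using YX[of "m - Suc i"] s(3,4)[of "m - Suc i"] that by (simp_all add: Suc_diff_Suc)
  show "interlaces_left (DZ (Suc m)) (EZ (Suc m))"
    unfolding EZ_def DZ_def sets image_reversed[of X "Suc m", symmetric]
      image_reversed[of Y "Suc m", symmetric]
    by (rule interlaces_leftI) (use XY YX' in simp_all)
  show "interlaces_left (DZ (Suc m)) (DZ m)"
    unfolding DZ_def sets image_reversed[of X "Suc m", symmetric]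
      image_reversed[of x m, symmetric]
    by (rule interlaces_leftI) (use Xx' xX' in simp_all)
qed

end

section \<open>The endpoints\<close>

lemma endpoints_u_v:
  fixes a b c d :: real
  assumes pos: "a > 0" "b > 0" "c > 0" "d > 0" and ad: "a * d = b * c"
  shows "endpoints a b (c / a) (u_end a b c d) (v_end a b c d)"
proof -
  define k where "k = c / a"
  define s where "s = b + c"
  define q where "q = sqrt (Delta_g a b c d)"
  have k: "k > 0" "a * k = c" "b * k = d" using pos ad by (auto simp: k_def field_simps)
  have s: "s > 0" using pos by (simp add: s_def)
  \<comment> \<open>Multiplying out turns the fixed-point equation into the quadratic g(z) = 0 whose
    roots are the \<open>x_g\<close> values.\<close>
  have fixed_iff: "z\<^sup>2 = (a * z + b) * (z + k) \<longleftrightarrow> (1 - a) * z\<^sup>2 - s * z - d = 0" for z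
    using k by (auto simp: s_def algebra_simps power2_eq_square)
  have "Delta_g a b c d = (b - c)\<^sup>2 + 4 * d"
    using ad by (simp add: Delta_g_def algebra_simps power2_eq_square)
  then have "Delta_g a b c d > 0" using pos by (simp add: add_nonneg_pos)
  then have q: "q > 0" "q\<^sup>2 = s\<^sup>2 + 4 * d * (1 - a)"
    by (auto simp: q_def s_def Delta_g_def)
  \<comment> \<open>Completing the square, which needs a nonzero leading coefficient.\<close>
  have fixedI: "z\<^sup>2 = (a * z + b) * (z + k)" if "(2 * (1 - a) * z - s)\<^sup>2 = q\<^sup>2" "a \<noteq> 1" for z
  proof -
    have "4 * (1 - a) * ((1 - a) * z\<^sup>2 - s * z - d) = (2 * (1 - a) * z - s)\<^sup>2 - q\<^sup>2"
      unfolding q(2) by (simp add: algebra_simps power2_eq_square)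
    then show ?thesis using that unfolding fixed_iff by simp
  qed

  have sign_iff: "a * z + b > 0 \<longleftrightarrow> - b / a < z" "a * z + b < 0 \<longleftrightarrow> z < - b / a" for z
    using pos by (auto simp: field_simps)
  have between: "x_g_minus a b c d < - b / a \<and> - b / a < x_g_plus a b c d \<and> x_g_plus a b c d < 0
      \<and> (x_g_minus a b c d)\<^sup>2 = (a * x_g_minus a b c d + b) * (x_g_minus a b c d + k)
      \<and> (x_g_plus a b c d)\<^sup>2 = (a * x_g_plus a b c d + b) * (x_g_plus a b c d + k)"
    if a: "a > 1"
  proof -
    define t where "t = 2 * (1 - a)"
    have t: "t < 0" using a by (simp add: t_def)
    have "2 * \<bar>1 - a\<bar> = - t" using a by (simp add: t_def)
    then have "x_g_minus a b c d = (s + q) / t" "x_g_plus a b c d = (s - q) / t"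
      using a unfolding x_g_minus_def x_g_plus_def s_def[symmetric] q_def[symmetric]
        t_def[symmetric] by (simp_all add: add_divide_distrib diff_divide_distrib)
    then have m: "2 * (1 - a) * x_g_minus a b c d = s + q"
      and p: "2 * (1 - a) * x_g_plus a b c d = s - q"
      using t unfolding t_def[symmetric] by simp_all
    \<comment> \<open>This is -4(1 - a) g(-b/a), and g(-b/a) = (b/a)^2 because az + b vanishes
      there. Its positivity puts the pole strictly between the two roots.\<close>
    have "q\<^sup>2 - (t * (- b / a) - s)\<^sup>2 = 4 * (a - 1) * (b / a)\<^sup>2"
      using pos ad unfolding q(2) t_def s_def by (simp add: field_simps power2_eq_square) algebra
    then have "(t * (- b / a) - s)\<^sup>2 < q\<^sup>2"
      using a pos by (smt (verit) mult_pos_pos zero_less_power divide_pos_pos)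
    then have "\<bar>t * (- b / a) - s\<bar> < q" using q(1) by (metis abs_le_square_iff abs_of_pos linorder_not_le)
    then have "t * (- b / a) < t * x_g_minus a b c d" "t * x_g_plus a b c d < t * (- b / a)"
      using m p unfolding t_def by linarith+
    then have 1: "x_g_minus a b c d < - b / a" "- b / a < x_g_plus a b c d"
      using t by (simp_all only: mult_less_cancel_left_neg)
    have "d * (1 - a) < 0" using a pos by (simp add: mult_pos_neg)
    then have "q\<^sup>2 < s\<^sup>2" unfolding q(2) mult.assoc by linarith
    then have "q < s" by (rule power2_less_imp_less) (use s in simp)
    then have "t * x_g_plus a b c d > 0" using p by (simp add: t_def)
    then have "x_g_plus a b c d < 0" using t by (simp add: zero_less_mult_iff)
    moreover have "(x_g_minus a b c d)\<^sup>2 = (a * x_g_minus a b c d + b) * (x_g_minus a b c d + k)"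
      by (rule fixedI, unfold m) (use a in simp_all)
    moreover have "(x_g_plus a b c d)\<^sup>2 = (a * x_g_plus a b c d + b) * (x_g_plus a b c d + k)"
      by (rule fixedI, unfold p) (use a in simp_all)
    ultimately show ?thesis using 1 by blast
  qed

  have v: "v_end a b c d < 0 \<and> a * v_end a b c d + b > 0
      \<and> (v_end a b c d)\<^sup>2 = (a * v_end a b c d + b) * (v_end a b c d + k)"
  proof (cases "a > 1")
    case True
    then have "v_end a b c d = x_g_plus a b c d" by (simp add: v_end_def)
    then show ?thesis unfolding sign_iff using between[OF True] by simp
  next
    case False
    define w where "w = v_end a b c d"
    have w_def': "w = x_g_minus a b c d" using False by (simp add: w_def v_end_def)
    have w: "w < 0 \<and> w\<^sup>2 = (a * w + b) * (w + k)"
    proof (cases "a = 1")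
      case True
      then have "w = - (d / s)" by (simp add: w_def' x_g_minus_def s_def)
      then show ?thesis using True s pos unfolding fixed_iff by simp
    next
      case neq: False
      have "d * (1 - a) > 0" using False neq pos by simp
      then have "s\<^sup>2 < q\<^sup>2" unfolding q(2) mult.assoc by linarith
      then have "q > s" by (rule power2_less_imp_less) (use q(1) in simp)
      moreover have eq: "2 * (1 - a) * w = s - q"
        using False neq
        by (simp add: w_def' x_g_minus_def s_def q_def diff_divide_distrib[symmetric])
      ultimately have "(1 - a) * w < 0" by linarith
      then have "w < 0" using False by (simp add: mult_less_0_iff)
      moreover have "w\<^sup>2 = (a * w + b) * (w + k)"
        by (rule fixedI, unfold eq) (use neq in simp_all)
      ultimately show ?thesis by blast
    qed
    \<comment> \<open>Otherwise both factors of w^2 = (aw + b)(w + k) are negative, with absolute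
      values below -aw and -w. Then w^2 < a w^2, contrary to a \<le> 1.\<close>
    have "a * w + b > 0"
    proof (rule ccontr)
      assume "\<not> a * w + b > 0"
      moreover have "0 < (a * w + b) * (w + k)" using w by (metis less_irrefl zero_less_power2)
      ultimately have "a * w + b < 0" "w + k < 0" unfolding zero_less_mult_iff by linarith+
      then have "(- (a * w + b)) * (- (w + k)) < (- (a * w)) * (- w)"
        using pos k w by (intro mult_strict_mono) auto
      then have "w\<^sup>2 < a * w\<^sup>2"
        unfolding minus_mult_minus power2_eq_square mult.assoc[symmetric]
        using w unfolding power2_eq_square by linarith
      moreover have "a * w\<^sup>2 \<le> w\<^sup>2"
        using mult_left_le_one_le[of "w\<^sup>2" a] False pos(1) by simp
      ultimately show False by simp
    qed
    then show ?thesis using w unfolding w_def by blast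
  qed

  have u: "a * u_end a b c d + b < 0 \<and> (a * u_end a b c d + b = - 4 * k \<and> u_end a b c d \<le> - 2 * k
      \<or> (u_end a b c d)\<^sup>2 = (a * u_end a b c d + b) * (u_end a b c d + k))"
  proof (cases "a \<le> 2")
    case False
    then have "u_end a b c d = x_g_minus a b c d" "a > 1" by (simp_all add: u_end_def)
    then show ?thesis unfolding sign_iff using between by simp
  next
    case True
    \<comment> \<open>With ad = bc the first two terms cancel, so the square root in
      \<open>x_Delta_minus\<close> is \<open>c\<close>.\<close>
    have "Delta_Delta a b c d = c\<^sup>2"
      using ad by (simp add: Delta_Delta_def power2_eq_square mult.assoc)
    then have ue: "u_end a b c d = (- (a * b) - 4 * c) / a\<^sup>2"
      using True pos by (simp add: u_end_def x_Delta_minus_def)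
    then have "a * u_end a b c d + b = - 4 * k"
      using pos by (simp add: k_def field_simps power2_eq_square)
    moreover have "u_end a b c d \<le> - 2 * k"
    proof -
      \<comment> \<open>The threshold 2 for \<open>a\<close> enters here: it places
        \<open>u_end\<close> at or below the double root \<open>- 2 * k\<close>.\<close>
      have "a * c \<le> 2 * c" "a * b > 0" using True pos by auto
      then have "- (a * b) - 4 * c \<le> - 2 * c * a" by (simp add: mult.commute)
      then have "u_end a b c d \<le> (- 2 * c * a) / a\<^sup>2"
        unfolding ue by (rule divide_right_mono) simp
      also have "\<dots> = - 2 * k" using pos by (simp add: k_def power2_eq_square)
      finally show ?thesis .
    qed
    ultimately show ?thesis using k by simp
  qed
  show ?thesis using pos k u v unfolding k_def[symmetric] by unfold_locales auto
qed

theorem theorem3p4: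
  fixes a b c d u v :: real
  assumes "a > 0" and "b > 0" and "c > 0" and "d > 0"
    and "a * d = b * c"
    and "u = u_end a b c d"
    and "v = v_end a b c d"
  shows "(\<forall>n. [:b, a:] ^ (n div 2) dvd W a b c d n)
    \<and> (\<forall>n\<ge>1. card (S a b c d (2 * n) \<inter> {u<..<v}) = n
            \<and> card (S a b c d (2 * n - 1) \<inter> {u<..<v}) = n - 1
            \<and> card (S a b c d (2 * n - 1) \<inter> {v<..0}) = 1)
    \<and> (\<forall>k\<in>{1, 2}. \<forall>n\<ge>k + 1.
         (odd n \<longrightarrow> interlaces_left (S a b c d n \<inter> {u<..<v}) (S a b c d (n - k) \<inter> {u<..<v}))
       \<and> (even n \<longrightarrow> interlaces_right (S a b c d n \<inter> {u<..<v}) (S a b c d (n - k) \<inter> {u<..<v})))"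
proof (intro conjI allI impI ballI)
  interpret endpoints a b "c / a" u v
    unfolding assms(6,7) by (rule endpoints_u_v[OF assms(1-5)])
  note S_eq' = S_eq[OF assms(1,5)]
  show "[:b, a:] ^ (n div 2) dvd W a b c d n" for n
    by (rule pow_dvd_W[OF assms(1,5)])
  {
    fix n :: nat assume n: "n \<ge> 1"
    then have odd: "2 * n - 1 = Suc (2 * (n - 1))" by simp
    show "card (S a b c d (2 * n) \<inter> {u<..<v}) = n"
      and "card (S a b c d (2 * n - 1) \<inter> {u<..<v}) = n - 1"
      and "card (S a b c d (2 * n - 1) \<inter> {v<..0}) = 1"
      unfolding odd S_eq' by (rule root_counts)+
  next
    fix k n :: nat assume k: "k \<in> {1, 2}" and n: "k + 1 \<le> n"
    show "interlaces_left (S a b c d n \<inter> {u<..<v}) (S a b c d (n - k) \<inter> {u<..<v})" if "odd n"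
    proof -
      obtain j where j: "n = Suc (2 * j)" using \<open>odd n\<close> by (auto elim: oddE)
      moreover obtain m where "j = Suc m" using j k n by (cases j) auto
      ultimately have m: "n = Suc (2 * Suc m)" by simp
      then have "n - 1 = 2 * Suc m" "n - 2 = Suc (2 * m)" using m by simp_all
      then show ?thesis using k interlacing(3,4)[of m] by (elim insertE emptyE) (simp_all only: m S_eq')
    qed
    show "interlaces_right (S a b c d n \<inter> {u<..<v}) (S a b c d (n - k) \<inter> {u<..<v})" if "even n"
    proof -
      obtain j where j: "n = 2 * j" using \<open>even n\<close> by (auto elim: evenE)
      moreover obtain m where "j = Suc m" using j n by (cases j) auto
      ultimately have m: "n = 2 * Suc m" by simp
      then have "n - 1 = Suc (2 * m)" "n - 2 = 2 * m" using m by simp_all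
      then show ?thesis using k interlacing(1,2)[of m] by (elim insertE emptyE) (simp_all only: m S_eq')
    qed
  }
qed

end
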